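(* Let $\mathcal{L}$ be a second-order linear operator on $\mathbb{R}^N$ satisfying assumptions (H1), (H2), (H3), (FS), (G), (L), (D) stated in the context. Let $F\subseteq\mathbb{R}^N$ and assume that there exists a $\Gamma$-cone $K\subseteq F$. Then there exists a real $p>1$ such that $F$ is $p_{\mathcal{L}}$-unbounded.
   Context: Operator: $\mathcal{L}=\frac{1}{V(x)}\sum_{i=1}^N\frac{\partial}{\partial x_i}\Big(\sum_{j=1}^N V(x)a_{i,j}(x)\frac{\partial}{\partial x_j}\Big)$ on $\mathbb{R}^N$, where: (H1) $V,a_{i,j}\in C^\infty(\mathbb{R}^N,\mathbb{R})$ for all $i,j$ and $V>0$ on $\mathbb{R}^N$; (H2) the matrix $A(x)=(a_{i,j}(x))_{i,j}$ is symmetric, positive semi-definite and $\mathrm{trace}(A(x))>0$ for every $x\in\mathbb{R}^N$; (H3) there is $\varepsilon>0$ such that both $\mathcal{L}$ and $\mathcal{L}-\varepsilon$ are $C^\infty$-hypoelliptic in every open subset of $\mathbb{R}^N$ (an operator $P$ is $C^\infty$-hypoelliptic in $\Omega$ if every distributional solution $u$ of $Pu=f$ is smooth in $\Omega$ whenever $f$ is smooth). (FS) There is a function $\Gamma:\{(x,y)\in\mathbb{R}^N\times\mathbb{R}^N:x\ne y\}\to\mathbb{R}$ which is $C^\infty$, strictly positive and symmetric, such that for every $x\in\mathbb{R}^N$: $\Gamma(x,\cdot)\in L^1_{\mathrm{loc}}(\mathbb{R}^N)$ and $\int_{\mathbb{R}^N}\Gamma(x,y)\,\mathcal{L}\varphi(y)\,V(y)\,dy=-\varphi(x)$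 for all $\varphi\in C_0^\infty(\mathbb{R}^N,\mathbb{R})$; $\lim_{y\to x}\Gamma(x,y)=\infty$; $\lim_{\|y\|\to\infty}\Gamma(x,y)=0$. Set $\gamma(x,y)=1/\Gamma(x,y)$ for $x\neq y$, $\gamma(x,x)=0$, and define the $\Gamma$-ball $\Omega(x,r)=\{y\in\mathbb{R}^N:\gamma(x,y)<r\}$ for $x\in\mathbb{R}^N$, $r>0$. (G) There is $\theta\in(0,1)$ such that $x\notin\Omega(y,r)$ implies $\Omega(x,\theta r)\cap\Omega(y,\theta r)=\varnothing$, for all $x,y\in\mathbb{R}^N$, $r>0$. (L) Every $\mathcal{L}$-harmonic function on $\mathbb{R}^N$ (smooth solution of $\mathcal{L}u=0$) which is bounded from above (or from below) is constant. (D) There are constants $2<\alpha'<\alpha''$ such that $\alpha'|\Omega(x,r)|\le|\Omega(x,2r)|\le\alpha''|\Omega(x,r)|$ for every $x\in\mathbb{R}^N$, $r>0$, where $|\cdot|$ is Lebesgue measure. $p_{\mathcal{L}}$-boundedness: for $p\in(1,\infty)$, $F\subseteq\mathbb{R}^N$ is $p_{\mathcal{L}}$-bounded if there is a countable family $\{\Omega(x_n,r_n)\}_{n\in J}$ of $\Gamma$-balls such that $F\subseteq\bigcup_{n\in J}\Omega(x_n,r_n)$ and $\sum_{n\in J}\big(r_n/\gamma(0,x_n)\big)^p<\infty$ (a term with $x_n=0$ counts as $+\infty$). $F$ is $p_{\mathcal{L}}$-unbounded if it is not $p_{\mathcal{L}}$-bounded. $\Gamma$-cone: a set $K\subseteq\mathbb{R}^N$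 is a $\Gamma$-cone if there is a sequence of $\Gamma$-balls $\{\Omega(z_j,R_j)\}_{j\in\mathbb{N}}$, all contained in $K$, such that $\|z_j\|\to\infty$ as $j\to\infty$ and $\liminf_{j\to\infty}R_j/\gamma(0,z_j)>0$. *)

theory Defs
  imports "HOL-Analysis.Analysis"
begin

subsection \<open>Smooth functions and test functions\<close>

definition partial :: "'a::euclidean_space \<Rightarrow> ('a \<Rightarrow> real) \<Rightarrow> 'a \<Rightarrow> real" where
  "partial b f x = frechet_derivative f (at x) b"

primrec partials :: "'a::euclidean_space list \<Rightarrow> ('a \<Rightarrow> real) \<Rightarrow> 'a \<Rightarrow> real" where
  "partials [] f = f"
| "partials (b # bs) f = partial b (partials bs f)"

text \<open>
  Only meant for open \<open>S\<close>.  All iterated partial derivatives are differentiable, hence also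
  continuous, at every point of \<open>S\<close>; the values of \<open>f\<close> outside \<open>S\<close> play no role.
\<close>

definition smooth_on :: "'a::euclidean_space set \<Rightarrow> ('a \<Rightarrow> real) \<Rightarrow> bool" where
  "smooth_on S f \<longleftrightarrow>
     (\<forall>bs. set bs \<subseteq> Basis \<longrightarrow> (\<forall>x\<in>S. partials bs f differentiable (at x)))"

definition supp :: "('a::euclidean_space \<Rightarrow> real) \<Rightarrow> 'a set" where
  "supp f = closure {x. f x \<noteq> 0}"

definition test_functions :: "'a::euclidean_space set \<Rightarrow> ('a \<Rightarrow> real) set" where
  "test_functions \<Omega> = {\<phi>. smooth_on UNIV \<phi> \<and> compact (supp \<phi>) \<and> supp \<phi> \<subseteq> \<Omega>}"

subsection \<open>Distributions\<close>

text \<open>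
  A distribution on \<open>\<Omega>\<close> is a functional whose values matter only on \<^term>\<open>test_functions \<Omega>\<close>.
  Continuity is expressed by the usual seminorm estimates: on each compact \<open>K\<close>, the value at
  \<open>\<phi>\<close> is at most \<open>C\<close> times any common bound \<open>M\<close> of the derivatives of \<open>\<phi>\<close> of order at most \<open>m\<close>.
\<close>

definition distribution_on ::
  "'a::euclidean_space set \<Rightarrow> (('a \<Rightarrow> real) \<Rightarrow> real) \<Rightarrow> bool" where
  "distribution_on \<Omega> u \<longleftrightarrow>
     (\<forall>\<phi>\<in>test_functions \<Omega>. \<forall>\<psi>\<in>test_functions \<Omega>. u (\<lambda>x. \<phi> x + \<psi> x) = u \<phi> + u \<psi>) \<and>
     (\<forall>\<phi>\<in>test_functions \<Omega>. \<forall>c. u (\<lambda>x. c * \<phi> x) = c * u \<phi>) \<and>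
     (\<forall>K. compact K \<and> K \<subseteq> \<Omega> \<longrightarrow>
        (\<exists>C m. \<forall>\<phi>\<in>test_functions \<Omega>. \<forall>M.
           supp \<phi> \<subseteq> K \<longrightarrow>
           (\<forall>bs. set bs \<subseteq> Basis \<and> length bs \<le> m \<longrightarrow> (\<forall>x. \<bar>partials bs \<phi> x\<bar> \<le> M)) \<longrightarrow>
           \<bar>u \<phi>\<bar> \<le> C * M))"

definition dist_of_fun :: "('a::euclidean_space \<Rightarrow> real) \<Rightarrow> ('a \<Rightarrow> real) \<Rightarrow> real" where
  "dist_of_fun f \<phi> = (LINT x|lborel. f x * \<phi> x)"

definition dist_partial ::
  "'a::euclidean_space \<Rightarrow> (('a \<Rightarrow> real) \<Rightarrow> real) \<Rightarrow> ('a \<Rightarrow> real) \<Rightarrow> real" where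
  "dist_partial b u \<phi> = - u (partial b \<phi>)"

definition dist_mult ::
  "('a \<Rightarrow> real) \<Rightarrow> (('a \<Rightarrow> real) \<Rightarrow> real) \<Rightarrow> ('a \<Rightarrow> real) \<Rightarrow> real" where
  "dist_mult g u \<phi> = u (\<lambda>x. g x * \<phi> x)"

text \<open>
  An operator is given here by its action \<open>P\<close> on distributions; equality of distributions on
  \<open>\<Omega>\<close> means agreement on \<^term>\<open>test_functions \<Omega>\<close>.
\<close>

definition hypoelliptic_in ::
  "((('a::euclidean_space \<Rightarrow> real) \<Rightarrow> real) \<Rightarrow> ('a \<Rightarrow> real) \<Rightarrow> real) \<Rightarrow> 'a set \<Rightarrow> bool" where
  "hypoelliptic_in P \<Omega> \<longleftrightarrow>
     (\<forall>u f. distribution_on \<Omega> u \<and> smooth_on \<Omega> f \<and>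
            (\<forall>\<phi>\<in>test_functions \<Omega>. P u \<phi> = dist_of_fun f \<phi>) \<longrightarrow>
        (\<exists>g. smooth_on \<Omega> g \<and> (\<forall>\<phi>\<in>test_functions \<Omega>. u \<phi> = dist_of_fun g \<phi>)))"

subsection \<open>The operator\<close>

definition L_op ::
  "(real^'n \<Rightarrow> real) \<Rightarrow> (real^'n \<Rightarrow> real^'n^'n) \<Rightarrow> (real^'n \<Rightarrow> real) \<Rightarrow> real^'n \<Rightarrow> real" where
  "L_op V A u x =
     1 / V x *
     (\<Sum>i\<in>UNIV. partial (axis i 1)
        (\<lambda>y. \<Sum>j\<in>UNIV. V y * A y $ i $ j * partial (axis j 1) u y) x)"

text \<open>The same expression, with the operations on distributions.\<close>

definition L_dist ::
  "(real^'n \<Rightarrow> real) \<Rightarrow> (real^'n \<Rightarrow> real^'n^'n) \<Rightarrow>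
   ((real^'n \<Rightarrow> real) \<Rightarrow> real) \<Rightarrow> (real^'n \<Rightarrow> real) \<Rightarrow> real" where
  "L_dist V A u =
     dist_mult (\<lambda>x. 1 / V x)
       (\<lambda>\<phi>. \<Sum>i\<in>UNIV. dist_partial (axis i 1)
          (\<lambda>\<psi>. \<Sum>j\<in>UNIV.
             dist_mult (\<lambda>y. V y * A y $ i $ j) (dist_partial (axis j 1) u) \<psi>) \<phi>)"

definition smooth_coefficients ::
  "(real^'n \<Rightarrow> real) \<Rightarrow> (real^'n \<Rightarrow> real^'n^'n) \<Rightarrow> bool" where
  "smooth_coefficients V A \<longleftrightarrow>
     smooth_on UNIV V \<and> (\<forall>i j. smooth_on UNIV (\<lambda>x. A x $ i $ j)) \<and> (\<forall>x. 0 < V x)"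

definition degenerate_elliptic :: "(real^'n \<Rightarrow> real^'n^'n) \<Rightarrow> bool" where
  "degenerate_elliptic A \<longleftrightarrow>
     (\<forall>x. transpose (A x) = A x \<and> (\<forall>\<xi>. 0 \<le> \<xi> \<bullet> (A x *v \<xi>)) \<and> 0 < trace (A x))"

definition hypoelliptic_family ::
  "(real^'n \<Rightarrow> real) \<Rightarrow> (real^'n \<Rightarrow> real^'n^'n) \<Rightarrow> bool" where
  "hypoelliptic_family V A \<longleftrightarrow>
     (\<exists>\<epsilon>>0. \<forall>\<Omega>. open \<Omega> \<longrightarrow>
        hypoelliptic_in (L_dist V A) \<Omega> \<and>
        hypoelliptic_in (\<lambda>u \<phi>. L_dist V A u \<phi> - \<epsilon> * u \<phi>) \<Omega>)"

text \<open>
  \<open>\<Gamma>\<close> lives off the diagonal; the values \<open>\<Gamma> x x\<close> are arbitrary and never matter.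
\<close>

definition fundamental_solution ::
  "(real^'n \<Rightarrow> real) \<Rightarrow> (real^'n \<Rightarrow> real^'n^'n) \<Rightarrow> (real^'n \<Rightarrow> real^'n \<Rightarrow> real) \<Rightarrow> bool" where
  "fundamental_solution V A \<Gamma> \<longleftrightarrow>
     smooth_on {p. fst p \<noteq> snd p} (\<lambda>p. \<Gamma> (fst p) (snd p)) \<and>
     (\<forall>x y. x \<noteq> y \<longrightarrow> 0 < \<Gamma> x y) \<and>
     (\<forall>x y. x \<noteq> y \<longrightarrow> \<Gamma> x y = \<Gamma> y x) \<and>
     (\<forall>x. (\<forall>K. compact K \<longrightarrow> set_integrable lborel K (\<Gamma> x)) \<and>
          (\<forall>\<phi>\<in>test_functions UNIV. (LINT y|lborel. \<Gamma> x y * L_op V A \<phi> y * V y) = - \<phi> x) \<and>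
          filterlim (\<Gamma> x) at_top (at x) \<and>
          (\<Gamma> x \<longlongrightarrow> 0) at_infinity)"

definition liouville :: "(real^'n \<Rightarrow> real) \<Rightarrow> (real^'n \<Rightarrow> real^'n^'n) \<Rightarrow> bool" where
  "liouville V A \<longleftrightarrow>
     (\<forall>u. smooth_on UNIV u \<and> (\<forall>x. L_op V A u x = 0) \<and>
          (bdd_above (range u) \<or> bdd_below (range u)) \<longrightarrow> u constant_on UNIV)"

subsection \<open>Balls of the fundamental solution\<close>

definition gam :: "(real^'n \<Rightarrow> real^'n \<Rightarrow> real) \<Rightarrow> real^'n \<Rightarrow> real^'n \<Rightarrow> real" where
  "gam \<Gamma> x y = (if x = y then 0 else 1 / \<Gamma> x y)"

definition gball :: "(real^'n \<Rightarrow> real^'n \<Rightarrow> real) \<Rightarrow> real^'n \<Rightarrow> real \<Rightarrow> (real^'n) set" where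
  "gball \<Gamma> x r = {y. gam \<Gamma> x y < r}"

definition ball_separation :: "(real^'n \<Rightarrow> real^'n \<Rightarrow> real) \<Rightarrow> bool" where
  "ball_separation \<Gamma> \<longleftrightarrow>
     (\<exists>\<theta>. 0 < \<theta> \<and> \<theta> < 1 \<and>
        (\<forall>x y r. 0 < r \<longrightarrow> x \<notin> gball \<Gamma> y r \<longrightarrow> gball \<Gamma> x (\<theta> * r) \<inter> gball \<Gamma> y (\<theta> * r) = {}))"

definition ball_doubling :: "(real^'n \<Rightarrow> real^'n \<Rightarrow> real) \<Rightarrow> bool" where
  "ball_doubling \<Gamma> \<longleftrightarrow>
     (\<exists>\<alpha>' \<alpha>''. 2 < \<alpha>' \<and> \<alpha>' < \<alpha>'' \<and>
        (\<forall>x r. 0 < r \<longrightarrow>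
           ennreal \<alpha>' * emeasure lebesgue (gball \<Gamma> x r) \<le> emeasure lebesgue (gball \<Gamma> x (2 * r)) \<and>
           emeasure lebesgue (gball \<Gamma> x (2 * r)) \<le> ennreal \<alpha>'' * emeasure lebesgue (gball \<Gamma> x r)))"

text \<open>
  Countable families are indexed by arbitrary sets \<open>J\<close> of naturals, so finite and empty families
  are included.  A term with \<open>x n = 0\<close> counts as \<open>\<infinity>\<close> in the sum, so finiteness of the sum excludes
  it; this must be said explicitly because \<open>r n / 0 = 0\<close>.
\<close>

definition pL_bounded ::
  "(real^'n \<Rightarrow> real^'n \<Rightarrow> real) \<Rightarrow> real \<Rightarrow> (real^'n) set \<Rightarrow> bool" where
  "pL_bounded \<Gamma> p F \<longleftrightarrow>
     (\<exists>(J :: nat set) x r.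
        (\<forall>n\<in>J. 0 < r n) \<and>
        F \<subseteq> (\<Union>n\<in>J. gball \<Gamma> (x n) (r n)) \<and>
        (\<forall>n\<in>J. x n \<noteq> 0) \<and>
        (\<lambda>n. (r n / gam \<Gamma> 0 (x n)) powr p) summable_on J)"

definition pL_unbounded ::
  "(real^'n \<Rightarrow> real^'n \<Rightarrow> real) \<Rightarrow> real \<Rightarrow> (real^'n) set \<Rightarrow> bool" where
  "pL_unbounded \<Gamma> p F \<longleftrightarrow> \<not> pL_bounded \<Gamma> p F"

definition gcone :: "(real^'n \<Rightarrow> real^'n \<Rightarrow> real) \<Rightarrow> (real^'n) set \<Rightarrow> bool" where
  "gcone \<Gamma> K \<longleftrightarrow>
     (\<exists>z R. (\<forall>j::nat. 0 < R j \<and> gball \<Gamma> (z j) (R j) \<subseteq> K) \<and>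
        filterlim (\<lambda>j. norm (z j)) at_top sequentially \<and>
        0 < liminf (\<lambda>j. ereal (R j / gam \<Gamma> 0 (z j))))"

end

theory Submission
  imports Defs
begin

text \<open>
  Condition (G) makes \<open>\<gamma>\<close> a quasi-metric, and the lower doubling bound shows that the volume of
  \<open>\<Omega>(x, t s)\<close> is at most a constant times \<open>t powr p\<close> times that of \<open>\<Omega>(x, s)\<close>, where
  \<open>p = log 2 \<alpha>' > 1\<close>.  Given a cover of the cone by balls \<open>\<Omega>(x\<^sub>n, r\<^sub>n)\<close> with finite \<open>p\<close>-sum,
  drop finitely many of them so that the remaining sum is small.  A ball
  \<open>\<Omega>(z\<^sub>j, c \<gamma>(0, z\<^sub>j))\<close> of the cone with \<open>j\<close> large misses the dropped balls, and each remaining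
  ball that meets it has \<open>\<gamma>(0, x\<^sub>n)\<close> of order at most \<open>\<gamma>(0, z\<^sub>j)\<close>.  So the remaining balls
  cover only a small fraction of the volume of that ball, a contradiction.
\<close>

section \<open>Volumes of balls in a doubling quasi-metric\<close>

locale doubling_quasimetric =
  fixes d :: "'a::euclidean_space \<Rightarrow> 'a \<Rightarrow> real" and k \<alpha> \<beta> :: real
  assumes nonneg: "0 \<le> d x y"
    and refl: "d x x = 0"
    and sym: "d x y = d y x"
    and quasi_triangle: "d x y \<le> k * max (d x z) (d z y)"
    and k_ge_1: "1 \<le> k"
    and \<alpha>_gt_2: "2 < \<alpha>"
    and open_balls: "open {y. d x y < r}"
    and bounded_balls: "bounded {y. d x y < r}"
    and doubling_lower:
      "0 < r \<Longrightarrow> \<alpha> * measure lebesgue {y. d x y < r} \<le> measure lebesgue {y. d x y < 2 * r}"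
    and doubling_upper:
      "0 < r \<Longrightarrow> measure lebesgue {y. d x y < 2 * r} \<le> \<beta> * measure lebesgue {y. d x y < r}"
begin

abbreviation B :: "'a \<Rightarrow> real \<Rightarrow> 'a set" where
  "B x r \<equiv> {y. d x y < r}"

abbreviation vol :: "'a set \<Rightarrow> real" where
  "vol S \<equiv> measure lebesgue S"

lemma B_lmeasurable: "B x r \<in> lmeasurable"
  using lmeasurable_open[OF bounded_balls open_balls] .

lemma vol_B_pos: "0 < r \<Longrightarrow> 0 < vol (B x r)"
proof -
  assume "0 < r"
  then have "x \<in> B x r"
    using refl by simp
  then have "\<not> negligible (B x r)"
    using open_not_negligible[OF open_balls, of x r] by blast
  then show ?thesis
    using B_lmeasurable negligible_iff_measure0 zero_less_measure_iff by blast
qed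

lemma B_mono: "r \<le> s \<Longrightarrow> B x r \<subseteq> B x s"
  by auto

lemma vol_mono: "S \<subseteq> B x r \<Longrightarrow> S \<in> lmeasurable \<Longrightarrow> vol S \<le> vol (B x r)"
  by (intro measure_mono_fmeasurable B_lmeasurable) (auto simp: fmeasurableD)

lemma vol_lower_iter: "0 < r \<Longrightarrow> \<alpha> ^ m * vol (B x r) \<le> vol (B x (2 ^ m * r))"
proof (induction m)
  case (Suc m)
  have "\<alpha> ^ Suc m * vol (B x r) \<le> \<alpha> * vol (B x (2 ^ m * r))"
    using Suc \<alpha>_gt_2 by (simp add: mult.assoc)
  also have "\<dots> \<le> vol (B x (2 * (2 ^ m * r)))"
    using Suc.prems by (intro doubling_lower) simp
  finally show ?case by (simp add: mult.assoc)
qed simp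

lemma \<beta>_nonneg: "0 \<le> \<beta>"
proof (rule ccontr)
  assume "\<not> 0 \<le> \<beta>"
  then have "\<beta> * vol (B undefined 1) < 0"
    using vol_B_pos[of 1 undefined] by (simp add: mult_less_0_iff)
  then show False
    using doubling_upper[of 1 undefined] measure_nonneg[of lebesgue "B undefined (2 * 1)"] by linarith
qed

lemma vol_upper_iter: "0 < r \<Longrightarrow> vol (B x (2 ^ m * r)) \<le> \<beta> ^ m * vol (B x r)"
proof (induction m)
  case (Suc m)
  have "vol (B x (2 * (2 ^ m * r))) \<le> \<beta> * vol (B x (2 ^ m * r))"
    using Suc.prems by (intro doubling_upper) simp
  also have "\<dots> \<le> \<beta> ^ Suc m * vol (B x r)"
    using Suc \<beta>_nonneg by (simp add: mult.assoc mult_left_mono)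
  finally show ?case by (simp add: mult.assoc)
qed simp

text \<open>Rounding \<open>M\<close> up to a power of two reduces this to iterated upper doubling;
  the constant depends on \<open>M\<close> only, not on the ball.\<close>

lemma vol_upper: "\<exists>C\<ge>0. \<forall>x r. 0 < r \<longrightarrow> vol (B x (M * r)) \<le> C * vol (B x r)"
proof -
  obtain m where m: "M < 2 ^ m"
    using real_arch_pow[of 2 M] by auto
  have "vol (B x (M * r)) \<le> \<beta> ^ m * vol (B x r)" if "0 < r" for x r
    using vol_upper_iter[OF that, of x m] m that
      vol_mono[OF B_mono B_lmeasurable, of "M * r" "2 ^ m * r" x] by fastforce
  then show ?thesis
    using \<beta>_nonneg zero_le_power by blast
qed

text \<open>Take the largest \<open>m\<close> with \<open>t * 2 ^ m \<le> 1\<close>. Then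
  \<open>m\<close> lower doublings of \<open>B x (t * s)\<close> stay inside \<open>B x s\<close>,
  so its volume is at most \<open>\<alpha> ^ (-m)\<close> times that of \<open>B x s\<close>. Since
  \<open>\<alpha>\<close> is \<open>2 powr log 2 \<alpha>\<close> and \<open>t * 2 ^ (m + 1)\<close>
  is at least 1, this factor is at most \<open>\<alpha> * t powr log 2 \<alpha>\<close>; the extra
  \<open>\<alpha>\<close> pays for rounding the logarithm.\<close>

lemma vol_decay:
  assumes "0 < t" "t \<le> 1" "0 < s"
  shows "vol (B x (t * s)) \<le> \<alpha> * t powr log 2 \<alpha> * vol (B x s)"
proof -
  define m where "m = nat \<lfloor>log 2 (1 / t)\<rfloor>"
  have "0 \<le> log 2 (1 / t)"
    using assms by simp
  then have m: "real m \<le> log 2 (1 / t)" "log 2 (1 / t) < real m + 1"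
    unfolding m_def by linarith+
  have p: "2 powr log 2 \<alpha> = \<alpha>"
    using \<alpha>_gt_2 by simp
  have "2 powr real m \<le> 1 / t" "1 / t < 2 powr (real m + 1)"
    using m assms by (simp_all add: le_log_iff log_less_iff)
  then have le: "t * 2 ^ m \<le> 1" and ge: "1 \<le> t * 2 powr (real m + 1)"
    using assms by (simp_all add: powr_realpow field_simps)
  have "1 \<le> (t * 2 powr (real m + 1)) powr log 2 \<alpha>"
    using ge \<alpha>_gt_2 by (intro ge_one_powr_ge_zero) auto
  also have "\<dots> = t powr log 2 \<alpha> * (2 powr log 2 \<alpha>) powr (real m + 1)"
    using assms by (simp add: powr_mult powr_powr mult.commute)
  also have "\<dots> = t powr log 2 \<alpha> * (\<alpha> ^ m * \<alpha>)"
    using p \<alpha>_gt_2 by (simp add: powr_add powr_realpow)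
  finally have key: "1 \<le> t powr log 2 \<alpha> * (\<alpha> ^ m * \<alpha>)" .
  have "vol (B x (t * s)) \<le> t powr log 2 \<alpha> * (\<alpha> ^ m * \<alpha>) * vol (B x (t * s))"
    using mult_right_mono[OF key, of "vol (B x (t * s))"] by simp
  also have "\<dots> = \<alpha> * t powr log 2 \<alpha> * (\<alpha> ^ m * vol (B x (t * s)))"
    by simp
  also have "\<dots> \<le> \<alpha> * t powr log 2 \<alpha> * vol (B x (2 ^ m * (t * s)))"
    using assms \<alpha>_gt_2 by (intro mult_left_mono vol_lower_iter) auto
  also have "\<dots> \<le> \<alpha> * t powr log 2 \<alpha> * vol (B x s)"
    using le assms \<alpha>_gt_2 mult_right_mono[OF le, of s]
    by (intro mult_left_mono vol_mono B_mono B_lmeasurable) (auto simp: mult_ac)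
  finally show ?thesis .
qed

section \<open>Small balls that meet a ball of the cone\<close>

text \<open>If \<open>d y x\<close> dominated in the quasi-triangle inequality through
  \<open>y\<close>, then \<open>d a x \<le> k * d y x < k * r < d a x\<close>. The lemma serves
  twice: for the small covering balls, and for the ball of radius \<open>c * d a z\<close> around
  \<open>z\<close>, where \<open>k * c < 1\<close> supplies the premise.\<close>

lemma dist_centre_le:
  assumes "k * r < d a x" "y \<in> B x r"
  shows "d a x \<le> k * d a y"
proof -
  have "k * d y x < k * r"
    using assms(2) k_ge_1 sym[of y x] by simp
  then have "k * d y x < d a x"
    using assms(1) by linarith
  then show ?thesis
    using quasi_triangle[of a x y] k_ge_1 by (auto simp: max_def split: if_splits)
qed

text \<open>With \<rho> = \<open>d a z\<close>, a common point of the two balls gives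
  \<open>d a x \<le> k\<^sup>2 * \<rho>\<close>. Hence \<open>B x r\<close> lies in
  \<open>B x (t * (k\<^sup>2 * \<rho>))\<close> for \<open>t = r / d a x\<close>, and
  \<open>vol_decay\<close> extracts the factor \<open>t powr log 2 \<alpha>\<close>. The remaining
  ball \<open>B x (k\<^sup>2 * \<rho>)\<close> sits in a fixed multiple of
  \<open>B z (c * \<rho>)\<close>, which upper doubling compares with
  \<open>B z (c * \<rho>)\<close> itself.\<close>

lemma vol_small_ball_meeting:
  assumes c: "0 < c" "k * c < 1"
  shows "\<exists>C>0. \<forall>a z x r. 0 < d a z \<longrightarrow> 0 < r \<longrightarrow> k * r < d a x \<longrightarrow>
    B x r \<inter> B z (c * d a z) \<noteq> {} \<longrightarrow>
    vol (B x r) \<le> C * (r / d a x) powr log 2 \<alpha> * vol (B z (c * d a z))"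
proof -
  \<comment> \<open>Two quasi-triangle steps, through \<open>a\<close> and then through
    \<open>x\<close>, put \<open>B x (k\<^sup>2 * \<rho>)\<close> within distance
    \<open>k ^ 4 * \<rho>\<close> of \<open>z\<close>. The factor 2 makes the inequality strict, and
    dividing by \<open>c\<close> expresses the radius as a multiple of
    \<open>c * \<rho>\<close>.\<close>
  obtain C where C: "0 \<le> C"
    "\<And>z r. 0 < r \<Longrightarrow> vol (B z ((2 * k ^ 4 / c) * r)) \<le> C * vol (B z r)"
    using vol_upper by meson
  \<comment> \<open>Adding 1 makes the constant positive, as \<open>C\<close> is only known to be
    nonnegative; later one divides by it.\<close>
  have "vol (B x r) \<le> (\<alpha> * C + 1) * (r / d a x) powr log 2 \<alpha> * vol (B z (c * d a z))"
    if pos: "0 < d a z" "0 < r" and small: "k * r < d a x"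
      and meet: "B x r \<inter> B z (c * d a z) \<noteq> {}" for a z x r
  proof -
    define \<rho> where "\<rho> = d a z"
    have \<rho>: "0 < \<rho>" using pos by (simp add: \<rho>_def)
    have k: "0 < k" using k_ge_1 by simp
    have X: "0 < d a x" using small pos k by (smt (verit) mult_pos_pos)
    obtain y where y: "y \<in> B x r" "d z y < c * \<rho>"
      using meet by (auto simp: \<rho>_def)
    have c1: "c < 1"
      using c k_ge_1 mult_right_mono[of 1 k c] by linarith
    have "c * \<rho> < \<rho>"
      using c1 \<rho> by simp
    then have "d z y \<le> \<rho>"
      using y(2) by simp
    then have "d a y \<le> k * \<rho>"
      using quasi_triangle[of a y z] by (simp add: \<rho>_def max_def)
    then have "k * d a y \<le> k\<^sup>2 * \<rho>"
      using k by (simp add: power2_eq_square)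
    then have Xle: "d a x \<le> k\<^sup>2 * \<rho>"
      using dist_centre_le[OF small y(1)] by simp
    define t where "t = r / d a x"
    have rX: "r < d a x"
      using small k_ge_1 pos mult_right_mono[of 1 k r] by linarith
    have t: "0 < t" "t \<le> 1"
      using X pos rX by (simp_all add: t_def)
    have "r = t * d a x"
      using X by (simp add: t_def)
    also have "\<dots> \<le> t * (k\<^sup>2 * \<rho>)"
      using Xle t by (intro mult_left_mono) auto
    finally have "vol (B x r) \<le> vol (B x (t * (k\<^sup>2 * \<rho>)))"
      by (intro vol_mono B_mono B_lmeasurable)
    also have "\<dots> \<le> \<alpha> * t powr log 2 \<alpha> * vol (B x (k\<^sup>2 * \<rho>))"
      using t \<rho> k by (intro vol_decay) auto
    also have "\<dots> \<le> \<alpha> * t powr log 2 \<alpha> * vol (B z ((2 * k ^ 4 / c) * (c * \<rho>)))"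
    proof (intro mult_left_mono vol_mono B_lmeasurable subsetI)
      fix w assume "w \<in> B x (k\<^sup>2 * \<rho>)"
      then have w: "d x w < k\<^sup>2 * \<rho>" by simp
      have "\<rho> \<le> k\<^sup>2 * \<rho>"
        using \<rho> k_ge_1 by simp
      then have "max (d z a) (d a x) \<le> k\<^sup>2 * \<rho>"
        using Xle sym[of z a] by (simp add: \<rho>_def)
      then have zx: "d z x \<le> k ^ 3 * \<rho>"
        using quasi_triangle[of z x a] mult_left_mono[of _ "k\<^sup>2 * \<rho>" k] k
        by (smt (verit) mult.assoc power2_eq_square power3_eq_cube)
      have "k\<^sup>2 * \<rho> \<le> k ^ 3 * \<rho>"
        using k_ge_1 \<rho> by (intro mult_right_mono power_increasing) auto
      then have "max (d z x) (d x w) \<le> k ^ 3 * \<rho>"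
        using zx w by simp
      then have "d z w \<le> k * (k ^ 3 * \<rho>)"
        using quasi_triangle[of z w x] mult_left_mono[of _ "k ^ 3 * \<rho>" k] k by (smt (verit))
      also have "\<dots> = k ^ 4 * \<rho>"
        by (simp add: power_numeral_reduce)
      also have "\<dots> < 2 * k ^ 4 * \<rho>"
        using k \<rho> by simp
      finally show "w \<in> B z (2 * k ^ 4 / c * (c * \<rho>))"
        using assms by simp
    qed (use \<alpha>_gt_2 in auto)
    also have "\<dots> \<le> \<alpha> * t powr log 2 \<alpha> * (C * vol (B z (c * \<rho>)))"
      using \<rho> assms \<alpha>_gt_2 by (intro mult_left_mono C) auto
    also have "\<dots> = (\<alpha> * C) * (t powr log 2 \<alpha> * vol (B z (c * \<rho>)))"
      by simp
    also have "\<dots> \<le> (\<alpha> * C + 1) * (t powr log 2 \<alpha> * vol (B z (c * \<rho>)))"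
      by (intro mult_right_mono) auto
    finally show ?thesis
      by (simp add: t_def \<rho>_def mult.assoc)
  qed
  moreover have "0 < \<alpha> * C + 1"
    using C(1) \<alpha>_gt_2 by (simp add: add_nonneg_pos)
  ultimately show ?thesis by blast
qed

section \<open>The covering argument\<close>

lemma cone_cover_not_summable:
  assumes c: "0 < c" "k * c < 1"
    and sep: "\<And>x. x \<noteq> a \<Longrightarrow> 0 < d a x"
    and lim: "filterlim (\<lambda>j. d a (z j)) at_top sequentially"
    and cover: "\<forall>\<^sub>F j in sequentially. B (z j) (c * d a (z j)) \<subseteq> (\<Union>n\<in>J. B (x n) (r n))"
    and r: "\<And>n. n \<in> J \<Longrightarrow> 0 < r n"
    and x: "\<And>n. n \<in> J \<Longrightarrow> x n \<noteq> a"
  shows "\<not> (\<lambda>n::nat. (r n / d a (x n)) powr log 2 \<alpha>) summable_on J"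
proof
  define f where "f n = (r n / d a (x n)) powr log 2 \<alpha>" for n
  assume "(\<lambda>n. (r n / d a (x n)) powr log 2 \<alpha>) summable_on J"
  then have f: "f summable_on J"
    by (simp add: f_def[abs_def])
  have k: "0 < k" using k_ge_1 by simp
  have p: "0 < log 2 \<alpha>" using \<alpha>_gt_2 by simp
  obtain C where C: "0 < C" "\<And>z x r. 0 < d a z \<Longrightarrow> 0 < r \<Longrightarrow> k * r < d a x \<Longrightarrow>
      B x r \<inter> B z (c * d a z) \<noteq> {} \<Longrightarrow>
      vol (B x r) \<le> C * (r / d a x) powr log 2 \<alpha> * vol (B z (c * d a z))"
    using vol_small_ball_meeting[OF c] by meson
  \<comment> \<open>The first bound forces \<open>k * r n < d a (x n)\<close> for every remaining
    ball, because each single term is at most the tail sum. The second makes the covered fraction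
    \<open>C * \<epsilon>\<close> less than 1. Halving makes both inequalities strict.\<close>
  define \<epsilon> where "\<epsilon> = min ((1 / k) powr log 2 \<alpha>) (1 / C) / 2"
  have \<epsilon>: "0 < \<epsilon>" "\<epsilon> < (1 / k) powr log 2 \<alpha>" "C * \<epsilon> < 1"
    using k C(1) by (auto simp: \<epsilon>_def min_def field_simps)
  obtain J0 where J0: "finite J0" "J0 \<subseteq> J" "dist (sum f J0) (infsum f J) \<le> \<epsilon>"
    using infsum_finite_approximation[OF f \<epsilon>(1)] by auto
  define J1 where "J1 = J - J0"
  have f1: "f summable_on J1"
    using summable_on_subset_banach[OF f] by (simp add: J1_def)
  have "infsum f J1 = infsum f J - sum f J0"
    unfolding J1_def using J0 f by (subst infsum_Diff) auto
  then have tail: "infsum f J1 \<le> \<epsilon>"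
    using J0(3) by (simp add: dist_real_def)
  have fin_tail: "sum f G \<le> \<epsilon>" if "finite G" "G \<subseteq> J1" for G
    using finite_sum_le_infsum[OF f1 that] tail by (simp add: f_def)
  have small: "k * r n < d a (x n)" if n: "n \<in> J1" for n
  proof -
    have X: "0 < d a (x n)" using n sep x by (simp add: J1_def)
    have "f n < (1 / k) powr log 2 \<alpha>"
      using fin_tail[of "{n}"] n \<epsilon> by simp
    then have "r n / d a (x n) < 1 / k"
      unfolding f_def using k p powr_less_cancel2[of "log 2 \<alpha>" "r n / d a (x n)" "1 / k"] X r n
      by (simp add: J1_def)
    then show ?thesis
      using X k by (simp add: field_simps)
  qed
  \<comment> \<open>Points of a dropped ball lie within \<open>k * (d a (x n) + r n)\<close> of
    \<open>a\<close>, while points of the cone ball are at distance at least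
    \<open>d a (z j) / k\<close>. So the dropped balls are missed once \<open>d a (z j)\<close>
    exceeds \<open>M\<close>. A sum instead of a maximum covers the case of empty
    \<open>J0\<close>.\<close>
  define M where "M = k\<^sup>2 * (\<Sum>n\<in>J0. d a (x n) + r n)"
  have "\<forall>\<^sub>F j in sequentially. max 0 M < d a (z j)"
    using lim unfolding filterlim_at_top_dense by blast
  then obtain j where j: "max 0 M < d a (z j)"
    "B (z j) (c * d a (z j)) \<subseteq> (\<Union>n\<in>J. B (x n) (r n))"
    using eventually_happens'[OF sequentially_bot eventually_conj[OF _ cover]] by blast
  define U where "U = B (z j) (c * d a (z j))"
  have zpos: "0 < d a (z j)"
    using j(1) by simp
  have far: "B (x n) (r n) \<inter> U = {}" if n: "n \<in> J0" for n
  proof (rule ccontr)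
    assume "B (x n) (r n) \<inter> U \<noteq> {}"
    then obtain y where y: "d (x n) y < r n" "y \<in> U" by auto
    have "k * (c * d a (z j)) < d a (z j)"
      using mult_strict_right_mono[OF c(2) zpos] by (simp add: mult.assoc)
    then have "d a (z j) \<le> k * d a y"
      using y(2) unfolding U_def by (rule dist_centre_le)
    also have "\<dots> \<le> k * (k * max (d a (x n)) (d (x n) y))"
      using quasi_triangle[of a y "x n"] k by (intro mult_left_mono) auto
    also have "\<dots> \<le> k * (k * (d a (x n) + r n))"
      using y(1) nonneg[of a "x n"] nonneg[of "x n" y] k by (intro mult_left_mono) auto
    also have "\<dots> = k\<^sup>2 * (d a (x n) + r n)"
      by (simp add: power2_eq_square)
    also have "\<dots> \<le> M"
      unfolding M_def using n J0 r
      by (intro mult_left_mono member_le_sum)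
        (auto intro!: add_nonneg_nonneg nonneg intro: less_imp_le)
    finally show False using j(1) by simp
  qed
  \<comment> \<open>Padding with empty sets turns the traces on \<open>U\<close> of the remaining
    balls into a sequence indexed by all naturals. Balls that miss \<open>U\<close>, to which the
    volume estimate does not apply, contribute nothing.\<close>
  define E where "E n = (if n \<in> J1 then B (x n) (r n) \<inter> U else {})" for n
  have E_meas: "E n \<in> lmeasurable" for n
    by (auto simp: E_def U_def intro!: fmeasurable.Int B_lmeasurable)
  have E_vol: "vol (E n) \<le> (if n \<in> J1 then C * f n * vol U else 0)" for n
  proof (cases "n \<in> J1 \<and> B (x n) (r n) \<inter> U \<noteq> {}")
    case True
    then have "vol (E n) \<le> vol (B (x n) (r n))"
      by (intro vol_mono E_meas) (auto simp: E_def)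
    also have "\<dots> \<le> C * f n * vol U"
      unfolding f_def U_def using True zpos small r
      by (intro C) (auto simp: U_def J1_def)
    finally show ?thesis using True by simp
  next
    case False
    then show ?thesis using C(1) by (auto simp: E_def f_def)
  qed
  have "U \<subseteq> (\<Union>n. E n)"
    using j(2) far by (fastforce simp: E_def J1_def U_def)
  moreover have "(\<Union>n. E n) \<subseteq> U"
    by (auto simp: E_def)
  ultimately have U: "U = (\<Union>n. E n)" by blast
  \<comment> \<open>A bound on the finite unions that is uniform in \<open>n\<close> passes to the
    countable union, which is all of \<open>U\<close>.\<close>
  have "vol (\<Union>i\<le>n. E i) \<le> C * \<epsilon> * vol U" for n
  proof -
    have "vol (\<Union>i\<le>n. E i) \<le> (\<Sum>i\<le>n. vol (E i))"
      using E_meas by (intro measure_UNION_le fmeasurableD) auto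
    also have "\<dots> \<le> (\<Sum>i\<le>n. if i \<in> J1 then C * f i * vol U else 0)"
      by (intro sum_mono E_vol)
    also have "\<dots> = C * sum f ({..n} \<inter> J1) * vol U"
      by (simp add: sum.inter_restrict[symmetric] sum_distrib_left sum_distrib_right)
    also have "\<dots> \<le> C * \<epsilon> * vol U"
      using C(1) by (intro mult_right_mono mult_left_mono fin_tail) auto
    finally show ?thesis .
  qed
  then have "vol (\<Union>n. E n) \<le> C * \<epsilon> * vol U"
    by (rule measure_countable_Union_le[OF E_meas])
  then have "vol U \<le> C * \<epsilon> * vol U"
    using U by simp
  moreover have "0 < vol U"
    unfolding U_def using zpos c by (intro vol_B_pos) simp
  ultimately show False
    using \<epsilon>(3) by simp
qed

end

section \<open>Metric properties of the reciprocal of the fundamental solution\<close>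

context
  fixes V :: "real^'n \<Rightarrow> real" and A :: "real^'n \<Rightarrow> real^'n^'n"
    and \<Gamma> :: "real^'n \<Rightarrow> real^'n \<Rightarrow> real"
  assumes fs: "fundamental_solution V A \<Gamma>"
begin

lemma gam_pos: "x \<noteq> y \<Longrightarrow> 0 < gam \<Gamma> x y"
  using fs by (simp add: gam_def fundamental_solution_def)

lemma gam_nonneg: "0 \<le> gam \<Gamma> x y"
  using gam_pos[of x y] by (cases "x = y") (auto simp: gam_def)

lemma gam_sym: "gam \<Gamma> x y = gam \<Gamma> y x"
  using fs by (auto simp: gam_def fundamental_solution_def)

text \<open>Positivity of \<Gamma> makes its decay to 0 one-sided, so the reciprocal tends to plus
  infinity.\<close>

lemma gam_at_infinity: "filterlim (gam \<Gamma> x) at_top at_infinity"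
proof -
  have ne: "\<forall>\<^sub>F y in at_infinity. x \<noteq> y"
    by (auto simp: eventually_at_infinity intro!: exI[of _ "norm x + 1"])
  have "(\<Gamma> x \<longlongrightarrow> 0) at_infinity"
    using fs by (simp add: fundamental_solution_def)
  moreover have "\<forall>\<^sub>F y in at_infinity. \<Gamma> x y \<in> {0<..}"
    using ne by eventually_elim (use fs in \<open>simp add: fundamental_solution_def\<close>)
  ultimately have "filterlim (\<Gamma> x) (at_right 0) at_infinity"
    by (simp add: filterlim_at eventually_mono)
  then have "filterlim (\<lambda>y. inverse (\<Gamma> x y)) at_top at_infinity"
    by (rule filterlim_compose[OF filterlim_inverse_at_top_right])
  moreover have "\<forall>\<^sub>F y in at_infinity. inverse (\<Gamma> x y) = gam \<Gamma> x y"
    using ne by eventually_elim (simp add: gam_def field_simps)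
  ultimately show ?thesis
    using filterlim_cong by force
qed

text \<open>At \<open>y = x\<close> the pole of \<Gamma> makes the reciprocal tend to 0, the value
  prescribed there. Elsewhere joint differentiability of \<Gamma> is restricted to the slice with
  first argument \<open>x\<close>, and a neighbourhood of \<open>y\<close> avoids
  \<open>x\<close>.\<close>

lemma continuous_gam: "isCont (gam \<Gamma> x) y"
proof (cases "x = y")
  case True
  have "filterlim (\<Gamma> x) at_top (at x)"
    using fs by (simp add: fundamental_solution_def)
  then have "((\<lambda>y. inverse (\<Gamma> x y)) \<longlongrightarrow> 0) (at x)"
    by (rule tendsto_inverse_0_at_top)
  moreover have "\<forall>\<^sub>F y in at x. inverse (\<Gamma> x y) = gam \<Gamma> x y"
    unfolding eventually_at_filter by (auto simp: gam_def field_simps)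
  ultimately have "(gam \<Gamma> x \<longlongrightarrow> 0) (at x)"
    using tendsto_cong by force
  then show ?thesis
    using True by (simp add: isCont_def gam_def)
next
  case False
  have "(\<lambda>p. \<Gamma> (fst p) (snd p)) differentiable at (x, y)"
    using fs False unfolding fundamental_solution_def smooth_on_def
    by (auto dest!: spec[of _ "[]"])
  then have "isCont (\<lambda>p. \<Gamma> (fst p) (snd p)) (x, y)"
    by (rule differentiable_imp_continuous_within)
  then have "isCont (\<lambda>y. \<Gamma> (fst (x, y)) (snd (x, y))) y"
    by (rule isCont_o2[rotated]) (intro continuous_intros)
  moreover have "\<Gamma> x y \<noteq> 0"
    using fs False unfolding fundamental_solution_def by (metis less_irrefl)
  ultimately have "isCont (\<lambda>y. 1 / \<Gamma> x y) y"
    by (intro continuous_divide continuous_const) simp_all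
  moreover have "\<forall>\<^sub>F w in nhds y. 1 / \<Gamma> x w = gam \<Gamma> x w"
    using t1_space_nhds[of y x] False by (auto simp: gam_def elim: eventually_mono)
  ultimately show ?thesis
    using isCont_cong[of "\<lambda>w. 1 / \<Gamma> x w" "gam \<Gamma> x" y] by blast
qed

lemma open_gball: "open (gball \<Gamma> x r)"
  unfolding gball_def
  by (intro open_Collect_less continuous_on_const continuous_at_imp_continuous_on ballI
      continuous_gam)

lemma bounded_gball: "bounded (gball \<Gamma> x r)"
proof -
  have "\<forall>\<^sub>F y in at_infinity. r \<le> gam \<Gamma> x y"
    using gam_at_infinity by (simp add: filterlim_at_top)
  then obtain b where "\<And>y. b \<le> norm y \<Longrightarrow> r \<le> gam \<Gamma> x y"
    by (auto simp: eventually_at_infinity)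
  then show ?thesis
    unfolding bounded_iff gball_def by (metis mem_Collect_eq not_less linear)
qed

text \<open>Apply (G) with \<open>r = gam \<Gamma> x y\<close>: by symmetry \<open>x\<close> is not
  in \<open>gball \<Gamma> y r\<close>, so no \<open>z\<close> lies in both balls of radius
  \<open>\<theta> * r\<close>. This is the claim with \<open>k = 1 / \<theta>\<close>.\<close>

lemma gam_quasi_triangle:
  assumes "ball_separation \<Gamma>"
  shows "\<exists>k\<ge>1. \<forall>x y z. gam \<Gamma> x y \<le> k * max (gam \<Gamma> x z) (gam \<Gamma> z y)"
proof -
  obtain \<theta> where \<theta>: "0 < \<theta>" "\<theta> < 1" and
    sep: "\<And>x y r. 0 < r \<Longrightarrow> x \<notin> gball \<Gamma> y r \<Longrightarrow> gball \<Gamma> x (\<theta> * r) \<inter> gball \<Gamma> y (\<theta> * r) = {}"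
    using assms unfolding ball_separation_def by blast
  have "gam \<Gamma> x y \<le> 1 / \<theta> * max (gam \<Gamma> x z) (gam \<Gamma> z y)" for x y z
  proof (rule ccontr)
    let ?r = "gam \<Gamma> x y"
    assume "\<not> ?thesis"
    then have lt: "max (gam \<Gamma> x z) (gam \<Gamma> z y) < \<theta> * ?r"
      using \<theta> by (simp add: field_simps not_le del: max_less_iff_conj)
    then have "0 < \<theta> * ?r"
      using gam_nonneg[of x z] by linarith
    then have "0 < ?r"
      using \<theta> by (simp add: zero_less_mult_iff)
    then have "gball \<Gamma> x (\<theta> * ?r) \<inter> gball \<Gamma> y (\<theta> * ?r) = {}"
      by (rule sep) (simp add: gball_def gam_sym[of y x])
    moreover have "z \<in> gball \<Gamma> x (\<theta> * ?r) \<inter> gball \<Gamma> y (\<theta> * ?r)"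
      using lt gam_sym[of y z] by (simp add: gball_def)
    ultimately show False by blast
  qed
  then show ?thesis
    using \<theta> by (intro exI[of _ "1 / \<theta>"]) auto
qed

lemma gam_doubling_quasimetric:
  assumes "ball_separation \<Gamma>" "ball_doubling \<Gamma>"
  shows "\<exists>k \<alpha> \<beta>. doubling_quasimetric (gam \<Gamma>) k \<alpha> \<beta>"
proof -
  obtain k where k: "1 \<le> k" "\<And>x y z. gam \<Gamma> x y \<le> k * max (gam \<Gamma> x z) (gam \<Gamma> z y)"
    using gam_quasi_triangle[OF assms(1)] by blast
  obtain \<alpha> \<beta> where \<alpha>: "2 < \<alpha>" "\<alpha> < \<beta>" and
    doubling: "\<And>x r. 0 < r \<Longrightarrow>
      ennreal \<alpha> * emeasure lebesgue (gball \<Gamma> x r) \<le> emeasure lebesgue (gball \<Gamma> x (2 * r)) \<and>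
      emeasure lebesgue (gball \<Gamma> x (2 * r)) \<le> ennreal \<beta> * emeasure lebesgue (gball \<Gamma> x r)"
    using assms(2) unfolding ball_doubling_def by blast
  \<comment> \<open>The balls are open and bounded, hence of finite measure, so the doubling bounds
    descend from extended to real numbers.\<close>
  have em: "emeasure lebesgue (gball \<Gamma> x r) = ennreal (measure lebesgue (gball \<Gamma> x r))" for x r
    using lmeasurable_open[OF bounded_gball open_gball] by (simp add: emeasure_eq_measure2)
  have scale: "ennreal \<alpha> * ennreal t = ennreal (\<alpha> * t)" "ennreal \<beta> * ennreal t = ennreal (\<beta> * t)" for t
    using \<alpha> by (auto intro!: ennreal_mult'[symmetric])
  have "doubling_quasimetric (gam \<Gamma>) k \<alpha> \<beta>"
  proof
    show "gam \<Gamma> x x = 0" for x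
      by (simp add: gam_def)
    show "gam \<Gamma> x y \<le> k * max (gam \<Gamma> x z) (gam \<Gamma> z y)" for x y z
      by (rule k)
    show "open {y. gam \<Gamma> x y < r}" "bounded {y. gam \<Gamma> x y < r}" for x r
      using open_gball[of x r] bounded_gball[of x r] by (simp_all add: gball_def)
    show "\<alpha> * measure lebesgue {y. gam \<Gamma> x y < r} \<le> measure lebesgue {y. gam \<Gamma> x y < 2 * r}"
      "measure lebesgue {y. gam \<Gamma> x y < 2 * r} \<le> \<beta> * measure lebesgue {y. gam \<Gamma> x y < r}"
      if "0 < r" for x r
      using doubling[OF that, of x] \<alpha>
      by (simp_all add: em scale gball_def[symmetric] del: ennreal_le_iff2)
  qed (fact gam_nonneg gam_sym k(1) \<alpha>(1))+
  then show ?thesis by blast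
qed

end

section \<open>From a \<Gamma>-cone to the covering argument\<close>

theorem theorem1p8:
  fixes V :: "real^'n \<Rightarrow> real"
    and A :: "real^'n \<Rightarrow> real^'n^'n"
    and \<Gamma> :: "real^'n \<Rightarrow> real^'n \<Rightarrow> real"
    and F K :: "(real^'n) set"
  assumes "smooth_coefficients V A"
    and "degenerate_elliptic A"
    and "hypoelliptic_family V A"
    and "fundamental_solution V A \<Gamma>"
    and "ball_separation \<Gamma>"
    and "liouville V A"
    and "ball_doubling \<Gamma>"
    and "gcone \<Gamma> K"
    and "K \<subseteq> F"
  shows "\<exists>p>1. pL_unbounded \<Gamma> p F"
proof -
  note fs = \<open>fundamental_solution V A \<Gamma>\<close>
  obtain k \<alpha> \<beta> where dq: "doubling_quasimetric (gam \<Gamma>) k \<alpha> \<beta>"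
    using gam_doubling_quasimetric[OF fs assms(5,7)] by blast
  interpret doubling_quasimetric "gam \<Gamma>" k \<alpha> \<beta> by (fact dq)
  obtain z R where zR: "\<And>j::nat. 0 < R j" "\<And>j. gball \<Gamma> (z j) (R j) \<subseteq> K"
    and lim: "filterlim (\<lambda>j. norm (z j)) at_top sequentially"
    and liminf: "0 < liminf (\<lambda>j. ereal (R j / gam \<Gamma> 0 (z j)))"
    using assms(8) unfolding gcone_def by blast
  obtain c0 where c0: "0 < ereal c0" "ereal c0 < liminf (\<lambda>j. ereal (R j / gam \<Gamma> 0 (z j)))"
    using ereal_dense2[OF liminf] by blast
  \<comment> \<open>Lying below the liminf, \<open>c0\<close> keeps the concentric balls of radius
    \<open>c * gam \<Gamma> 0 (z j)\<close> inside the cone for large \<open>j\<close>; the cap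
    \<open>1 / (2 * k)\<close> ensures \<open>k * c < 1\<close>.\<close>
  define c where "c = min c0 (1 / (2 * k))"
  have c: "0 < c" "c \<le> c0" "k * c < 1"
    using c0 k_ge_1 by (auto simp: c_def min_def field_simps)
  have zlim: "filterlim (\<lambda>j. gam \<Gamma> 0 (z j)) at_top sequentially"
    by (rule filterlim_compose[OF gam_at_infinity[OF fs]])
      (use lim in \<open>simp add: filterlim_norm_at_top_imp_at_infinity\<close>)
  have "\<forall>\<^sub>F j in sequentially. c0 < R j / gam \<Gamma> 0 (z j)"
    using c0(2) le_Liminf_iff[THEN iffD1, OF order_refl] by fastforce
  moreover have "\<forall>\<^sub>F j in sequentially. 0 < gam \<Gamma> 0 (z j)"
    using zlim by (simp add: filterlim_at_top_dense)
  ultimately have balls: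
    "\<forall>\<^sub>F j in sequentially. {y. gam \<Gamma> (z j) y < c * gam \<Gamma> 0 (z j)} \<subseteq> F"
  proof eventually_elim
    case (elim j)
    have "c * gam \<Gamma> 0 (z j) \<le> c0 * gam \<Gamma> 0 (z j)"
      using c elim by (intro mult_right_mono) auto
    also have "\<dots> \<le> R j"
      using elim by (simp add: field_simps)
    finally show ?case
      using zR(2)[of j] assms(9) by (fastforce simp: gball_def)
  qed
  \<comment> \<open>The witness is the decay exponent of ball volumes; it exceeds 1 exactly because
    the lower doubling constant exceeds 2.\<close>
  have "\<not> pL_bounded \<Gamma> (log 2 \<alpha>) F"
  proof
    assume "pL_bounded \<Gamma> (log 2 \<alpha>) F"
    then obtain J x r where r: "\<And>n. n \<in> J \<Longrightarrow> 0 < r n"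
      and F: "F \<subseteq> (\<Union>n\<in>J. gball \<Gamma> (x n) (r n))"
      and x: "\<And>n. n \<in> J \<Longrightarrow> x n \<noteq> 0"
      and sum: "(\<lambda>n::nat. (r n / gam \<Gamma> 0 (x n)) powr log 2 \<alpha>) summable_on J"
      unfolding pL_bounded_def by blast
    have cover: "\<forall>\<^sub>F j in sequentially.
        {y. gam \<Gamma> (z j) y < c * gam \<Gamma> 0 (z j)} \<subseteq> (\<Union>n\<in>J. {y. gam \<Gamma> (x n) y < r n})"
      using balls by eventually_elim (use F in \<open>simp add: gball_def\<close>)
    have "0 < gam \<Gamma> 0 y" if "y \<noteq> 0" for y
      using gam_pos[OF fs, of 0 y] that by simp
    from cone_cover_not_summable[OF c(1,3) this zlim cover r x] sum show False
      by simp
  qed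
  moreover have "1 < log 2 \<alpha>"
    using \<alpha>_gt_2 by simp
  ultimately show ?thesis
    unfolding pL_unbounded_def by blast
qed

end
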